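(* Let $R$ be a finite commutative ring with identity with Artin decomposition $R\simeq R_1\times\cdots\times R_s$, each $R_i$ a local ring, and let $k\in\mathbb{N}$ be such that $\gcd(k,|R|)=1$. If there is at most one index $j\in\{1,\dots,s\}$ such that $-1\notin U_{R_j,k}$, then $$\big(\mathcal{G}_R(k)\big)_{red}\simeq\mathcal{G}_{R_{red}}(k).$$
   Context: For a commutative ring $R$ with identity and a positive integer $k$, $R^*$ is the group of units, $U_{R,k}=\{x^k:x\in R^*\}$ and $T_{R,k}=U_{R,k}\cup(-U_{R,k})$. For an abelian group $A$ and $S\subseteq A$ with $0\notin S$ and $S=-S$, $X(A,S)$ denotes the Cayley graph with vertex set $A$ and $v,w$ adjacent iff $w-v\in S$. The symmetrized $k$-th unitary Cayley graph is $\mathcal{G}_R(k)=X(R,T_{R,k})$. $R_{red}=R/\mathcal{N}_R$, where $\mathcal{N}_R$ is the nilradical of $R$. Reduced graph: for an undirected graph $\Gamma$ define $a\equiv b$ iff $N(a)=N(b)$, where $N(a)$ is the set of neighbors of $a$; $\Gamma_{red}$ is the graph whose vertices are the equivalence classes $[a]$, with $[a]$ adjacent to $[b]$ iff $a$ is adjacent to $b$ in $\Gamma$. $\simeq$ between graphs denotes isomorphism. *)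

theory Defs
  imports
    "HOL-Algebra.Chinese_Remainder"
    "Graph_Theory.Pair_Digraph"
    "Graph_Theory.Digraph_Isomorphism"
begin

section \<open>Rings\<close>

locale local_ring = cring +
  assumes unique_maximalideal: "\<exists>!M. maximalideal M R"

definition nilradical :: "('a, 'm) ring_scheme \<Rightarrow> 'a set" where
  "nilradical R = {x \<in> carrier R. \<exists>n::nat. x [^]\<^bsub>R\<^esub> n = \<zero>\<^bsub>R\<^esub>}"

definition reduced_ring :: "('a, 'm) ring_scheme \<Rightarrow> 'a set ring" where
  "reduced_ring R = R Quot (nilradical R)"

definition unit_powers :: "('a, 'm) ring_scheme \<Rightarrow> nat \<Rightarrow> 'a set" where
  "unit_powers R k = {x [^]\<^bsub>R\<^esub> k | x. x \<in> Units R}"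

definition sym_unit_powers :: "('a, 'm) ring_scheme \<Rightarrow> nat \<Rightarrow> 'a set" where
  "sym_unit_powers R k = unit_powers R k \<union> a_inv R ` unit_powers R k"


section \<open>Graphs\<close>

text \<open>
  An undirected graph is a \<^typ>\<open>'a pair_pre_digraph\<close> with a symmetric arc relation; an
  isomorphism of undirected graphs is then the same thing as an isomorphism of the
  symmetric digraphs.
\<close>

text \<open>
  The abelian group is written additively, as in the locale \<^locale>\<open>abelian_group\<close>; only the
  carrier and the additive structure of the record are used. The definition is meant for
  sets of group elements with \<open>0 \<notin> S\<close> and \<open>S = -S\<close>.
\<close>
definition cayley_graph :: "('a, 'm) ring_scheme \<Rightarrow> 'a set \<Rightarrow> 'a pair_pre_digraph" where
  "cayley_graph A S =
     \<lparr> pverts = carrier A,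
       parcs = {(v, w). v \<in> carrier A \<and> w \<in> carrier A \<and> w \<ominus>\<^bsub>A\<^esub> v \<in> S} \<rparr>"

definition sym_unitary_cayley_graph :: "('a, 'm) ring_scheme \<Rightarrow> nat \<Rightarrow> 'a pair_pre_digraph" where
  "sym_unitary_cayley_graph R k = cayley_graph R (sym_unit_powers R k)"

definition nbrs :: "'a pair_pre_digraph \<Rightarrow> 'a \<Rightarrow> 'a set" where
  "nbrs \<Gamma> a = {b \<in> pverts \<Gamma>. (a, b) \<in> parcs \<Gamma>}"

definition same_nbrs :: "'a pair_pre_digraph \<Rightarrow> 'a rel" where
  "same_nbrs \<Gamma> = {(a, b). a \<in> pverts \<Gamma> \<and> b \<in> pverts \<Gamma> \<and> nbrs \<Gamma> a = nbrs \<Gamma> b}"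

definition reduced_graph :: "'a pair_pre_digraph \<Rightarrow> 'a set pair_pre_digraph" where
  "reduced_graph \<Gamma> =
     \<lparr> pverts = pverts \<Gamma> // same_nbrs \<Gamma>,
       parcs = {(same_nbrs \<Gamma> `` {a}, same_nbrs \<Gamma> `` {b}) | a b.
                  a \<in> pverts \<Gamma> \<and> b \<in> pverts \<Gamma> \<and> (a, b) \<in> parcs \<Gamma>} \<rparr>"

text \<open>Adjacency of classes does not depend on the representatives.\<close>

lemma reduced_graph_adjacent_iff:
  assumes "sym (parcs \<Gamma>)" and "a \<in> pverts \<Gamma>" and "b \<in> pverts \<Gamma>"
  shows "(same_nbrs \<Gamma> `` {a}, same_nbrs \<Gamma> `` {b}) \<in> parcs (reduced_graph \<Gamma>)
           \<longleftrightarrow> (a, b) \<in> parcs \<Gamma>"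
proof
  assume "(same_nbrs \<Gamma> `` {a}, same_nbrs \<Gamma> `` {b}) \<in> parcs (reduced_graph \<Gamma>)"
  then obtain c d where cd: "c \<in> pverts \<Gamma>" "d \<in> pverts \<Gamma>" "(c, d) \<in> parcs \<Gamma>"
    and eq: "same_nbrs \<Gamma> `` {a} = same_nbrs \<Gamma> `` {c}" "same_nbrs \<Gamma> `` {b} = same_nbrs \<Gamma> `` {d}"
    by (auto simp: reduced_graph_def)
  have "a \<in> same_nbrs \<Gamma> `` {a}" "b \<in> same_nbrs \<Gamma> `` {b}"
    using assms by (auto simp: same_nbrs_def)
  hence n: "nbrs \<Gamma> c = nbrs \<Gamma> a" "nbrs \<Gamma> d = nbrs \<Gamma> b"
    unfolding eq by (auto simp: same_nbrs_def)
  have "d \<in> nbrs \<Gamma> a" using cd n(1) by (auto simp: nbrs_def)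
  hence "a \<in> nbrs \<Gamma> d" using assms by (auto simp: nbrs_def dest: symD)
  hence "(b, a) \<in> parcs \<Gamma>" unfolding n(2) by (auto simp: nbrs_def)
  thus "(a, b) \<in> parcs \<Gamma>" using assms(1) by (rule symD[rotated])
qed (use assms in \<open>auto simp: reduced_graph_def\<close>)

end

theory Submission
  imports Defs "HOL-Algebra.Sylow" "HOL-Algebra.Multiplicative_Group" "HOL-Algebra.Divisibility"
begin

text \<open>
  Write \<open>N\<close> for the nilradical of \<open>R\<close> and \<open>T\<close> for the connection set
  \<open>U \<union> -U\<close> of the Cayley graph, where \<open>U\<close> consists of the \<open>k\<close>-th powers of units. The
  neighbours of \<open>a\<close> are the elements of \<open>a + T\<close>, so \<open>a\<close> and \<open>b\<close> have the same neighbours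
  exactly if translation by \<open>b - a\<close> maps \<open>T\<close> to itself. The point of the proof is that the
  translations with this property are those by elements of \<open>N\<close>. The classes of the reduced graph
  are then literally the cosets of \<open>N\<close>, which are the elements of \<open>R/N\<close>; since units lift
  from \<open>R/N\<close> to \<open>R\<close>, the image of \<open>T\<close> is the connection set of \<open>R/N\<close>, and
  the reduced graph is not only isomorphic but equal to the Cayley graph of \<open>R/N\<close>
  (\<open>reduced_graph_sym_unitary_cayley_graph\<close>).

  Nilpotent translations preserve \<open>T\<close>: the units \<open>1 + N\<close> form a group with as many
  elements as \<open>N\<close>, and this number divides \<open>|R|\<close>, hence is prime to \<open>k\<close>. So
  every element of \<open>1 + N\<close> is a \<open>k\<close>-th power, and \<open>x\<^sup>k + a = x\<^sup>k (1 + x\<^sup>-\<^sup>k a)\<close>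
  is a \<open>k\<close>-th power as well for nilpotent \<open>a\<close> (\<open>sym_unit_powers_add_nilpotent\<close>).

  Conversely, pass to \<open>R/N\<close>, which has no nilpotent elements except \<open>0\<close>. In a finite reduced
  commutative ring no group \<open>T\<close> of units is invariant under translation by a nonzero element
  (\<open>unit_group_translation_free\<close>). Indeed, a multiple of that element would be an element \<open>e\<close>
  of prime additive order \<open>p\<close> under which \<open>T\<close> is still invariant. The subgroup
  \<open>F = {t \<in> T. p t = p}\<close> is also invariant under translation by \<open>e\<close>, so \<open>p\<close> divides
  \<open>|F|\<close>, and by Cauchy's theorem there is \<open>t \<in> F\<close> with \<open>t\<^sup>p = 1\<close> and \<open>t \<noteq> 1\<close>.
  But \<open>d = t - 1\<close> satisfies \<open>p d = 0\<close>, so \<open>1 = (1 + d)\<^sup>p = 1 + d\<^sup>p\<close>, and \<open>d\<close> is a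
  nonzero nilpotent element.
\<close>

section \<open>Nilpotent elements\<close>

context cring
begin

lemma nilradicalI: "x \<in> carrier R \<Longrightarrow> x [^] (n::nat) = \<zero> \<Longrightarrow> x \<in> nilradical R"
  by (auto simp: nilradical_def)

lemma nilradical_carrier: "x \<in> nilradical R \<Longrightarrow> x \<in> carrier R"
  by (simp add: nilradical_def)

text \<open>
  This much of the binomial theorem suffices for sums of nilpotent elements: if \<open>b\<^sup>n = 0\<close>, then
  \<open>(a + b)\<^sup>n\<close> is a multiple of \<open>a\<close> and hence nilpotent along with \<open>a\<close>.
\<close>
lemma pow_add_eq_pow_plus_multiple:
  assumes "a \<in> carrier R" "b \<in> carrier R"
  shows "\<exists>z\<in>carrier R. (a \<oplus> b) [^] (n::nat) = b [^] n \<oplus> a \<otimes> z"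
proof (induction n)
  case 0
  show ?case using assms by (intro bexI[of _ \<zero>]) auto
next
  case (Suc n)
  then obtain z where z: "z \<in> carrier R" "(a \<oplus> b) [^] n = b [^] n \<oplus> a \<otimes> z" by blast
  have b: "b [^] n \<in> carrier R" using assms by simp
  have "(a \<oplus> b) [^] Suc n = (b [^] n \<oplus> a \<otimes> z) \<otimes> (a \<oplus> b)"
    using z by simp
  also have "\<dots> = b [^] n \<otimes> b \<oplus> a \<otimes> (b [^] n \<oplus> z \<otimes> (a \<oplus> b))"
    using assms z(1) b by algebra
  finally show ?case using assms z(1) b by (intro bexI[of _ "b [^] n \<oplus> z \<otimes> (a \<oplus> b)"]) auto
qed

lemma nilradical_add:
  assumes "a \<in> nilradical R" "b \<in> nilradical R"
  shows "a \<oplus> b \<in> nilradical R"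
proof -
  obtain m n :: nat where a: "a \<in> carrier R" "a [^] m = \<zero>" and b: "b \<in> carrier R" "b [^] n = \<zero>"
    using assms by (auto simp: nilradical_def)
  obtain z where z: "z \<in> carrier R" "(a \<oplus> b) [^] n = a \<otimes> z"
    using pow_add_eq_pow_plus_multiple[OF a(1) b(1), of n] a(1) b(2) by auto
  have "(a \<oplus> b) [^] (n * m) = (a \<otimes> z) [^] m"
    using a(1) b(1) z by (simp add: nat_pow_pow[symmetric])
  also have "\<dots> = \<zero>" using a z(1) by (simp add: nat_pow_distrib)
  finally show ?thesis using a(1) b(1) by (intro nilradicalI) auto
qed

lemma nilradical_mult:
  assumes "a \<in> nilradical R" "x \<in> carrier R"
  shows "x \<otimes> a \<in> nilradical R"
proof -
  obtain m :: nat where a: "a \<in> carrier R" "a [^] m = \<zero>"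
    using assms by (auto simp: nilradical_def)
  have "(x \<otimes> a) [^] m = \<zero>" using a assms(2) by (simp add: nat_pow_distrib)
  thus ?thesis using a(1) assms(2) by (intro nilradicalI) auto
qed

lemma nilradical_zero: "\<zero> \<in> nilradical R"
  by (rule nilradicalI[of _ 1]) auto

lemma nilradical_minus:
  assumes "a \<in> nilradical R"
  shows "\<ominus> a \<in> nilradical R"
  using nilradical_mult[OF assms, of "\<ominus> \<one>"] nilradical_carrier[OF assms]
  by (simp add: l_minus)

lemma ideal_nilradical: "ideal (nilradical R) R"
proof (rule idealI)
  show "ring R" by (rule ring_axioms)
  show "subgroup (nilradical R) (add_monoid R)"
    using nilradical_zero nilradical_add nilradical_carrier nilradical_minus
    by (intro add.subgroupI) (auto simp: a_inv_def[symmetric])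
next
  fix a x assume "a \<in> nilradical R" "x \<in> carrier R"
  thus "x \<otimes> a \<in> nilradical R" "a \<otimes> x \<in> nilradical R"
    using nilradical_mult nilradical_carrier m_comm by auto
qed

lemma one_minus_times_geometric_sum:
  assumes "a \<in> carrier R"
  shows "\<exists>y\<in>carrier R. (\<one> \<ominus> a) \<otimes> y = \<one> \<ominus> a [^] (m::nat)"
proof (induction m)
  case 0
  show ?case using assms by (intro bexI[of _ \<zero>]) (auto simp: a_minus_def r_neg)
next
  case (Suc m)
  then obtain y where y: "y \<in> carrier R" "(\<one> \<ominus> a) \<otimes> y = \<one> \<ominus> a [^] m" by blast
  have am: "a [^] m \<in> carrier R" using assms by simp
  have "(\<one> \<ominus> a) \<otimes> (y \<oplus> a [^] m) = (\<one> \<ominus> a) \<otimes> y \<oplus> (\<one> \<ominus> a) \<otimes> a [^] m"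
    using assms y(1) am by algebra
  also have "\<dots> = \<one> \<ominus> a [^] m \<otimes> a"
    unfolding y(2) using assms am by algebra
  finally show ?case using y(1) am by (intro bexI[of _ "y \<oplus> a [^] m"]) auto
qed

lemma one_plus_nilpotent_unit:
  assumes "a \<in> nilradical R"
  shows "\<one> \<oplus> a \<in> Units R"
proof -
  have "\<ominus> a \<in> nilradical R" using assms by (rule nilradical_minus)
  then obtain m :: nat where m: "(\<ominus> a) [^] m = \<zero>" by (auto simp: nilradical_def)
  have a: "a \<in> carrier R" using assms by (rule nilradical_carrier)
  obtain y where "y \<in> carrier R" "(\<one> \<ominus> (\<ominus> a)) \<otimes> y = \<one>"
    using one_minus_times_geometric_sum[of "\<ominus> a" m] a m by (auto simp: a_minus_def)
  thus ?thesis using a by (auto simp: Units_def a_minus_def m_comm)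
qed

lemma unit_if_unit_mod_nilradical:
  assumes "x \<in> carrier R" "y \<in> carrier R" "x \<otimes> y \<ominus> \<one> \<in> nilradical R"
  shows "x \<in> Units R"
proof -
  have "\<one> \<oplus> (x \<otimes> y \<ominus> \<one>) = x \<otimes> y" using assms(1,2) by algebra
  hence "x \<otimes> y \<in> Units R" using one_plus_nilpotent_unit[OF assms(3)] by (simp only:)
  thus ?thesis using assms(1,2) by (rule unit_factor)
qed

text \<open>
  An inverse stays in the set because \<open>v = 1 + a\<close> gives \<open>v\<^sup>-\<^sup>1 = 1 - v\<^sup>-\<^sup>1 a\<close>.
\<close>
lemma subgroup_one_plus_nilradical: "subgroup ((\<oplus>) \<one> ` nilradical R) (units_of R)"
proof -
  interpret U: group "units_of R" by (rule units_group)
  show ?thesis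
  proof (rule U.subgroupI)
    show "(\<oplus>) \<one> ` nilradical R \<subseteq> carrier (units_of R)"
      by (auto simp: units_of_carrier one_plus_nilpotent_unit)
    show "(\<oplus>) \<one> ` nilradical R \<noteq> {}" using nilradical_zero by blast
  next
    fix v assume "v \<in> (\<oplus>) \<one> ` nilradical R"
    then obtain a where a: "a \<in> nilradical R" "v = \<one> \<oplus> a" by blast
    have v: "v \<in> Units R" using a one_plus_nilpotent_unit by simp
    have c: "a \<in> carrier R" "inv v \<in> carrier R" using a nilradical_carrier v by auto
    have "inv v \<otimes> v = inv v \<otimes> (\<one> \<oplus> a)" by (rule arg_cong[OF a(2)])
    hence *: "inv v \<oplus> inv v \<otimes> a = \<one>" using v c by (simp add: r_distr)
    have "inv v = (inv v \<oplus> inv v \<otimes> a) \<oplus> \<ominus> (inv v \<otimes> a)" using c by algebra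
    hence "inv v = \<one> \<oplus> \<ominus> (inv v \<otimes> a)" unfolding * .
    moreover have "\<ominus> (inv v \<otimes> a) \<in> nilradical R" using nilradical_mult[OF a(1) c(2)] by (rule nilradical_minus)
    ultimately show "inv\<^bsub>units_of R\<^esub> v \<in> (\<oplus>) \<one> ` nilradical R"
      using v by (auto simp: units_of_inv)
  next
    fix v w assume "v \<in> (\<oplus>) \<one> ` nilradical R" "w \<in> (\<oplus>) \<one> ` nilradical R"
    then obtain a b where ab: "a \<in> nilradical R" "v = \<one> \<oplus> a" "b \<in> nilradical R" "w = \<one> \<oplus> b"
      by blast
    have c: "a \<in> carrier R" "b \<in> carrier R" using ab nilradical_carrier by auto
    have "v \<otimes> w = \<one> \<oplus> (a \<oplus> (\<one> \<oplus> a) \<otimes> b)" unfolding ab using c by algebra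
    moreover have "a \<oplus> (\<one> \<oplus> a) \<otimes> b \<in> nilradical R"
      using ab c by (intro nilradical_add nilradical_mult) auto
    ultimately show "v \<otimes>\<^bsub>units_of R\<^esub> w \<in> (\<oplus>) \<one> ` nilradical R" by (simp add: units_of_mult)
  qed
qed

end

section \<open>Powers in finite groups\<close>

text \<open>
  By Bezout, \<open>k x = |H| y + 1\<close> for some \<open>x\<close> and \<open>y\<close>, so \<open>h\<^sup>x\<close> is a \<open>k\<close>-th root
  of \<open>h\<close>.
\<close>
lemma (in group) coprime_power_surj:
  assumes "subgroup H G" "finite H" "k > 0" "coprime k (card H)" "h \<in> H"
  shows "\<exists>g\<in>H. g [^] (k::nat) = h"
proof -
  interpret H: group "G\<lparr>carrier := H\<rparr>" using assms(1) by (rule subgroup_imp_group)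
  obtain x y where xy: "k * x = card H * y + 1"
    using bezout_nat[of k "card H"] assms(3,4) by auto
  have h: "h \<in> carrier G" using assms(1,5) subgroup.mem_carrier by metis
  have "h [^] card H = \<one>"
    using H.pow_order_eq_1[of h] assms(5) by (simp add: order_def nat_pow_consistent[symmetric])
  hence "h [^] (card H * y + 1) = h" using h by (simp add: nat_pow_mult[symmetric] nat_pow_pow[symmetric])
  hence "(h [^] x) [^] k = h" using h xy by (simp add: nat_pow_pow mult.commute)
  moreover have "h [^] x \<in> H"
    using H.nat_pow_closed[of h x] assms(5) by (simp add: nat_pow_consistent[symmetric])
  ultimately show ?thesis by blast
qed

text \<open>
  Cauchy's theorem, as the case of Sylow's theorem that yields a subgroup with exactly \<open>p\<close> elements:
  each of them has \<open>p\<close>-th power \<open>1\<close>.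
\<close>
lemma (in group) cauchy_subgroup:
  assumes "subgroup H G" "finite H" "Factorial_Ring.prime (p::nat)" "p dvd card H"
  shows "\<exists>x\<in>H. x \<noteq> \<one> \<and> x [^] p = \<one>"
proof -
  interpret H: group "G\<lparr>carrier := H\<rparr>" using assms(1) by (rule subgroup_imp_group)
  obtain m where "card H = p ^ 1 * m" using assms(4) by auto
  then obtain P where P: "subgroup P (G\<lparr>carrier := H\<rparr>)" "card P = p ^ 1"
    using sylow_thm[OF assms(3) H.group_axioms, of 1 m] assms(2) by (auto simp: order_def)
  interpret P: group "G\<lparr>carrier := H\<rparr>\<lparr>carrier := P\<rparr>" using P(1) by (rule H.subgroup_imp_group)
  have PH: "P \<subseteq> H" using subgroup.subset[OF P(1)] by simp
  have "\<not> P \<subseteq> {\<one>}"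
    using P(2) prime_gt_1_nat[OF assms(3)] card_mono[of "{\<one>}" P] by auto
  then obtain x where x: "x \<in> P" "x \<noteq> \<one>" by blast
  have "x [^] card P = \<one>"
    using P.pow_order_eq_1[of x] x(1) by (simp add: order_def nat_pow_def)
  thus ?thesis using x PH P(2) by auto
qed

section \<open>Translations that fix a group of units\<close>

context cring
begin

lemma one_plus_binomial:
  assumes "d \<in> carrier R"
  shows "(\<one> \<oplus> d) [^] n = (\<Oplus>i\<in>{..n}. [(n choose i)] \<cdot> (d [^] i))"
proof (induction n)
  case 0
  show ?case by simp
next
  case (Suc n)
  let ?f = "\<lambda>i. [(n choose i)] \<cdot> (d [^] i)"
  have f: "\<And>i. ?f i \<in> carrier R" using assms by simp
  define S where "S = (\<Oplus>i\<in>{..n}. ?f i)"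
  have S: "S \<in> carrier R" unfolding S_def using f by (intro finsum_closed) auto
  have Sd: "S \<otimes> d = (\<Oplus>i\<in>{..n}. [(n choose i)] \<cdot> (d [^] Suc i))"
    unfolding S_def using f assms
    by (subst finsum_ldistr) (auto intro!: finsum_cong' simp: add_pow_ldistr)
  have top: "(\<Oplus>i\<in>{..Suc n}. ?f i) = S"
    unfolding S_def using f assms by (simp add: finsum_Suc binomial_eq_0)
  have "(\<Oplus>i\<in>{..Suc n}. [(Suc n choose i)] \<cdot> (d [^] i))
      = (\<Oplus>i\<in>{..n}. [(Suc n choose Suc i)] \<cdot> (d [^] Suc i)) \<oplus> \<one>"
    using assms by (subst finsum_Suc2) auto
  also have "(\<Oplus>i\<in>{..n}. [(Suc n choose Suc i)] \<cdot> (d [^] Suc i))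
      = (\<Oplus>i\<in>{..n}. [(n choose i)] \<cdot> (d [^] Suc i) \<oplus> ?f (Suc i))"
    using assms by (intro finsum_cong') (auto simp: add.nat_pow_mult)
  also have "\<dots> = S \<otimes> d \<oplus> (\<Oplus>i\<in>{..n}. ?f (Suc i))"
    unfolding Sd using assms by (intro finsum_addf) auto
  also have "\<dots> \<oplus> \<one> = S \<otimes> d \<oplus> ((\<Oplus>i\<in>{..n}. ?f (Suc i)) \<oplus> ?f 0)"
    using assms S by (subst a_assoc) (auto intro!: finsum_closed)
  also have "(\<Oplus>i\<in>{..n}. ?f (Suc i)) \<oplus> ?f 0 = (\<Oplus>i\<in>{..Suc n}. ?f i)"
    using f by (subst finsum_Suc2) auto
  also have "S \<otimes> d \<oplus> \<dots> = S \<otimes> (\<one> \<oplus> d)"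
    unfolding top using S assms by algebra
  finally show ?case using Suc by (simp add: S_def)
qed

text \<open>
  The Frobenius identity for a single element \<open>d\<close> killed by \<open>p\<close>, in a form that applies to rings
  with several residue characteristics: the intermediate terms of the binomial expansion vanish because
  each contains both \<open>p\<close> and \<open>d\<close>.
\<close>
lemma one_plus_pow_prime:
  assumes "Factorial_Ring.prime (p::nat)" "d \<in> carrier R" "[p] \<cdot> d = \<zero>"
  shows "(\<one> \<oplus> d) [^] p = \<one> \<oplus> d [^] p"
proof -
  let ?f = "\<lambda>i. [(p choose i)] \<cdot> (d [^] i)"
  obtain r where r: "p = Suc (Suc r)"
    using prime_ge_2_nat[OF assms(1)] by (metis add_2_eq_Suc nat_le_iff_add)
  have f: "\<And>i. ?f i \<in> carrier R" using assms by simp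
  have mid: "?f (Suc i) = \<zero>" if "i \<le> r" for i
  proof -
    have "p dvd (p choose Suc i)"
      using that r assms(1) by (intro dvd_choose_prime) auto
    then obtain m where m: "p choose Suc i = p * m" by blast
    have "[p] \<cdot> (d [^] Suc i) = d [^] i \<otimes> ([p] \<cdot> d)"
      using assms(2) by (simp add: add_pow_rdistr)
    also have "\<dots> = \<zero>" using assms by simp
    finally have z: "[p] \<cdot> (d [^] Suc i) = \<zero>" .
    have "[(p * m)] \<cdot> (d [^] Suc i) = [m] \<cdot> ([p] \<cdot> (d [^] Suc i))"
      using assms(2) by (intro add.nat_pow_pow[symmetric]) simp
    also have "\<dots> = \<zero>" unfolding z by simp
    finally show ?thesis unfolding m .
  qed
  have "(\<Oplus>i\<in>{..r}. ?f (Suc i)) = \<zero>"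
    using mid by (intro add.finprod_one_eqI) auto
  hence "(\<Oplus>i\<in>{..Suc r}. ?f i) = \<one>"
    using f assms(2) by (subst finsum_Suc2) auto
  hence "(\<Oplus>i\<in>{..Suc (Suc r)}. ?f i) = d [^] p \<oplus> \<one>"
    using f assms(2) r by (subst finsum_Suc) auto
  thus ?thesis unfolding one_plus_binomial[OF assms(2)] r[symmetric]
    using assms(2) by (simp add: a_comm)
qed

text \<open>
  The elements whose translation maps \<open>T\<close> into itself are closed under addition. So a nonzero one
  of additive order \<open>n\<close> can be replaced by its multiple by \<open>n/p\<close>, for a prime divisor \<open>p\<close>
  of \<open>n\<close>.
\<close>
lemma translation_invariant_imp_prime_order:
  assumes "finite (carrier R)" "c \<in> carrier R" "c \<noteq> \<zero>" "\<And>t. t \<in> T \<Longrightarrow> t \<oplus> c \<in> T" "T \<subseteq> carrier R"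
  shows "\<exists>p c'. Factorial_Ring.prime (p::nat) \<and> c' \<in> carrier R \<and> (\<forall>t\<in>T. t \<oplus> c' \<in> T) \<and> (\<forall>n::nat. [n] \<cdot> c' = \<zero> \<longleftrightarrow> p dvd n)"
proof -
  define n where "n = add.ord c"
  have n: "[m] \<cdot> c = \<zero> \<longleftrightarrow> n dvd m" for m :: nat
    unfolding n_def using add.pow_eq_id assms(2) by blast
  have "n \<noteq> 0" unfolding n_def using add.ord_ge_1[OF _ assms(2)] assms(1) by simp
  moreover have "n \<noteq> 1" using n[of 1] assms(2,3) by auto
  ultimately obtain p where p: "Factorial_Ring.prime (p::nat)" "p dvd n" using prime_factor_nat by blast
  then obtain q where q: "n = q * p" by (metis dvd_def mult.commute)
  have "q \<noteq> 0" using \<open>n \<noteq> 0\<close> q by simp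
  have mult: "t \<oplus> [m] \<cdot> c \<in> T" if "t \<in> T" for t and m :: nat
  proof (induction m)
    case 0
    thus ?case using that assms(5) by auto
  next
    case (Suc m)
    have "t \<oplus> [Suc m] \<cdot> c = t \<oplus> [m] \<cdot> c \<oplus> c"
      using that assms(2,5) by (auto simp: a_assoc)
    thus ?case using assms(4)[OF Suc] by simp
  qed
  have "[m] \<cdot> ([q] \<cdot> c) = \<zero> \<longleftrightarrow> p dvd m" for m :: nat
    using assms(2) \<open>q \<noteq> 0\<close> by (simp add: add.nat_pow_pow n q)
  thus ?thesis using p(1) mult assms(2) by (intro exI[of _ p] exI[of _ "[q] \<cdot> c"]) auto
qed

text \<open>
  Inside \<open>T\<close>, the elements \<open>t\<close> that differ from \<open>1\<close> by an element killed by
  \<open>p\<close> form a group \<open>F\<close>. Additively, a translation of order \<open>p\<close> forces \<open>p\<close> to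
  divide \<open>|F|\<close>; multiplicatively, the Frobenius identity leaves \<open>F\<close> without elements of order
  \<open>p\<close> when there are no nilpotents.
\<close>
lemma unit_group_translation_free:
  assumes fin: "finite (carrier R)"
    and reduced: "\<And>x n. x \<in> carrier R \<Longrightarrow> x [^] (n::nat) = \<zero> \<Longrightarrow> x = \<zero>"
    and T: "subgroup T (units_of R)"
    and c: "c \<in> carrier R" "\<And>t. t \<in> T \<Longrightarrow> t \<oplus> c \<in> T"
  shows "c = \<zero>"
proof (rule ccontr)
  assume "c \<noteq> \<zero>"
  interpret U: group "units_of R" by (rule units_group)
  have TU: "T \<subseteq> Units R" using subgroup.subset[OF T] by (simp add: units_of_carrier)
  hence Tc: "T \<subseteq> carrier R" by auto
  obtain p e where p: "Factorial_Ring.prime p" and e: "e \<in> carrier R" "\<And>t. t \<in> T \<Longrightarrow> t \<oplus> e \<in> T"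
    and ord: "\<And>n::nat. [n] \<cdot> e = \<zero> \<longleftrightarrow> p dvd n"
    using translation_invariant_imp_prime_order[OF fin c(1) \<open>c \<noteq> \<zero>\<close> c(2) Tc] by blast
  define F where "F = {t \<in> T. [p] \<cdot> t = [p] \<cdot> \<one>}"
  have Fc: "F \<subseteq> carrier R" and FU: "F \<subseteq> Units R" using Tc TU by (auto simp: F_def)
  have finF: "finite F" using Fc fin by (rule finite_subset)
  have F: "subgroup F (units_of R)"
  proof (rule U.subgroupI)
    show "F \<subseteq> carrier (units_of R)" using FU by (simp add: units_of_carrier)
    show "F \<noteq> {}" using subgroup.one_closed[OF T] by (auto simp: F_def units_of_one)
  next
    fix t assume t: "t \<in> F"
    hence tU: "t \<in> Units R" and tT: "t \<in> T" using FU by (auto simp: F_def)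
    hence tc: "t \<in> carrier R" "inv t \<in> carrier R" by auto
    have "[p] \<cdot> (inv t) = ([p] \<cdot> \<one>) \<otimes> inv t" using tc by (simp add: add_pow_ldistr)
    also have "\<dots> = ([p] \<cdot> t) \<otimes> inv t" using t by (simp add: F_def)
    also have "\<dots> = [p] \<cdot> \<one>" using tc tU by (simp add: add_pow_ldistr)
    finally show "inv\<^bsub>units_of R\<^esub> t \<in> F"
      using tU subgroup.m_inv_closed[OF T tT] by (simp add: F_def units_of_inv)
  next
    fix t s assume ts: "t \<in> F" "s \<in> F"
    hence c: "t \<in> carrier R" "s \<in> carrier R" using Fc by auto
    have "[p] \<cdot> (t \<otimes> s) = ([p] \<cdot> t) \<otimes> s" using c by (simp add: add_pow_ldistr)
    also have "\<dots> = ([p] \<cdot> \<one>) \<otimes> s" using ts by (simp add: F_def)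
    also have "\<dots> = [p] \<cdot> s" using c by (simp add: add_pow_ldistr)
    finally show "t \<otimes>\<^bsub>units_of R\<^esub> s \<in> F"
      using ts subgroup.m_closed[OF T, of t s] by (simp add: F_def units_of_mult)
  qed
  have "[p] \<cdot> e = \<zero>" using ord by simp
  hence shift: "t \<oplus> e \<in> F" if "t \<in> F" for t
    using that e Fc by (auto simp: F_def add.nat_pow_distrib subset_iff)
  have inj: "inj_on (\<lambda>t. t \<oplus> e) F" using Fc e(1) by (intro inj_onI) (auto simp: subset_iff)
  hence bij: "(\<lambda>t. t \<oplus> e) ` F = F" using shift finF by (intro endo_inj_surj) auto
  have sum: "finsum R (\<lambda>t. t) F \<in> carrier R" using Fc by (intro finsum_closed) auto
  \<comment> \<open>Translation by \<open>e\<close> permutes \<open>F\<close>, so it changes the sum of all elements of \<open>F\<close>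
    both by \<open>0\<close> and by \<open>|F| e\<close>.\<close>
  have "finsum R (\<lambda>t. t) F = finsum R (\<lambda>t. t) ((\<lambda>t. t \<oplus> e) ` F)" by (simp add: bij)
  also have "\<dots> = finsum R (\<lambda>t. t \<oplus> e) F" using inj Fc e(1) by (subst finsum_reindex) auto
  also have "\<dots> = finsum R (\<lambda>t. t) F \<oplus> finsum R (\<lambda>t. e) F"
    using Fc e(1) by (intro finsum_addf) auto
  also have "finsum R (\<lambda>t. e) F = [card F] \<cdot> e" using e(1) by (simp add: add.finprod_const)
  finally have "[card F] \<cdot> e = \<zero>"
    using sum e(1) by (metis add.nat_pow_closed add.l_cancel_one')
  hence "p dvd card F" by (simp add: ord)
  then obtain t where t: "t \<in> F" "t \<noteq> \<one>" "t [^] p = \<one>"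
    using U.cauchy_subgroup[OF F finF p] FU by (auto simp: units_of_one units_of_pow subset_iff)
  define d where "d = t \<ominus> \<one>"
  have tc: "t \<in> carrier R" using t(1) Fc by auto
  hence d: "d \<in> carrier R" "t = \<one> \<oplus> d" unfolding d_def by (simp, algebra)
  have "[p] \<cdot> \<one> \<oplus> [p] \<cdot> d = [p] \<cdot> \<one>"
    using t(1) d by (simp add: F_def add.nat_pow_distrib)
  hence "[p] \<cdot> d = \<zero>" using d(1) by (metis add.nat_pow_closed add.l_cancel_one' one_closed)
  hence "\<one> \<oplus> d [^] p = \<one>" using one_plus_pow_prime[OF p d(1)] t(3) d(2) by simp
  hence "d [^] p = \<zero>" using d(1) by (metis nat_pow_closed add.l_cancel_one' one_closed)
  hence "d = \<zero>" using reduced d(1) by blast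
  thus False using t(2) d(2) by simp
qed


end

section \<open>Reduction modulo the nilradical\<close>

context cring
begin

lemma reduction_hom: "ring_hom_cring R (reduced_ring R) ((+>) (nilradical R))"
  unfolding reduced_ring_def using ideal.rcos_ring_hom_cring[OF ideal_nilradical] is_cring by blast

lemma reduction_pow:
  assumes "x \<in> carrier R"
  shows "nilradical R +> (x [^] (n::nat)) = (nilradical R +> x) [^]\<^bsub>reduced_ring R\<^esub> n"
  unfolding reduced_ring_def
  by (rule ring_hom_ring.hom_nat_pow[OF ideal.rcos_ring_hom_ring[OF ideal_nilradical] assms])

lemma carrier_reduced_ring: "carrier (reduced_ring R) = (+>) (nilradical R) ` carrier R"
  by (auto simp: reduced_ring_def FactRing_def A_RCOSETS_def RCOSETS_def a_r_coset_def)

lemma reduction_mem_iff: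
  assumes "a \<in> carrier R" "b \<in> carrier R"
  shows "b \<in> nilradical R +> a \<longleftrightarrow> b \<ominus> a \<in> nilradical R"
proof -
  interpret N: ideal "nilradical R" R by (rule ideal_nilradical)
  show ?thesis by (rule N.a_rcos_module_minus[OF ring_axioms assms])
qed

lemma reduction_eq_iff:
  assumes "a \<in> carrier R" "b \<in> carrier R"
  shows "nilradical R +> b = nilradical R +> a \<longleftrightarrow> b \<ominus> a \<in> nilradical R"
proof -
  interpret N: ideal "nilradical R" R by (rule ideal_nilradical)
  have "b \<in> nilradical R +> b" using assms(2) by (rule N.a_rcos_self)
  moreover have "nilradical R +> a = nilradical R +> b" if "b \<in> nilradical R +> a"
    using that assms(1) N.a_subgroup by (rule a_repr_independence)
  ultimately show ?thesis unfolding reduction_mem_iff[OF assms, symmetric] by metis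
qed

lemma reduction_coset:
  assumes "a \<in> carrier R"
  shows "nilradical R +> a = {b \<in> carrier R. nilradical R +> b = nilradical R +> a}"
proof -
  interpret N: ideal "nilradical R" R by (rule ideal_nilradical)
  have "nilradical R +> a \<subseteq> carrier R"
    using assms N.a_subset by (intro a_r_coset_subset_G) auto
  thus ?thesis using assms reduction_eq_iff[OF assms] reduction_mem_iff[OF assms] by blast
qed

lemma reduced_ring_reduced:
  assumes "X \<in> carrier (reduced_ring R)" "X [^]\<^bsub>reduced_ring R\<^esub> (n::nat) = \<zero>\<^bsub>reduced_ring R\<^esub>"
  shows "X = \<zero>\<^bsub>reduced_ring R\<^esub>"
proof -
  interpret h: ring_hom_cring R "reduced_ring R" "(+>) (nilradical R)" by (rule reduction_hom)
  obtain x where x: "x \<in> carrier R" "X = nilradical R +> x"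
    using assms(1) by (auto simp: carrier_reduced_ring)
  have "nilradical R +> (x [^] n) = nilradical R +> \<zero>"
    using assms(2) x reduction_pow[of x n] h.hom_zero by simp
  hence "x [^] n \<ominus> \<zero> \<in> nilradical R" using x(1) by (subst (asm) reduction_eq_iff) auto
  hence "x [^] n \<in> nilradical R" using x(1) by (simp add: a_minus_def)
  then obtain m :: nat where "(x [^] n) [^] m = \<zero>" by (auto simp: nilradical_def)
  hence "x \<in> nilradical R" using x(1) by (intro nilradicalI[of _ "n * m"]) (auto simp: nat_pow_pow)
  hence "nilradical R +> x = nilradical R +> \<zero>"
    using x(1) by (subst reduction_eq_iff) (auto simp: a_minus_def)
  thus ?thesis using x(2) h.hom_zero by simp
qed

lemma Units_reduced_ring: "Units (reduced_ring R) = (+>) (nilradical R) ` Units R"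
proof -
  interpret h: ring_hom_cring R "reduced_ring R" "(+>) (nilradical R)" by (rule reduction_hom)
  show ?thesis
  proof (intro equalityI subsetI)
    fix X assume X: "X \<in> Units (reduced_ring R)"
    then obtain Y where Y: "Y \<in> carrier (reduced_ring R)" "X \<otimes>\<^bsub>reduced_ring R\<^esub> Y = \<one>\<^bsub>reduced_ring R\<^esub>"
      by (auto simp: Units_def)
    obtain x where x: "x \<in> carrier R" "X = nilradical R +> x"
      using X by (auto simp: Units_def carrier_reduced_ring)
    obtain y where y: "y \<in> carrier R" "Y = nilradical R +> y"
      using Y(1) by (auto simp: carrier_reduced_ring)
    have "nilradical R +> (x \<otimes> y) = nilradical R +> \<one>"
      using Y(2) x y h.hom_mult[of x y] h.hom_one by simp
    hence "x \<otimes> y \<ominus> \<one> \<in> nilradical R" using x(1) y(1) by (subst (asm) reduction_eq_iff) auto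
    hence "x \<in> Units R" using x(1) y(1) by (intro unit_if_unit_mod_nilradical)
    thus "X \<in> (+>) (nilradical R) ` Units R" using x(2) by blast
  next
    fix X assume "X \<in> (+>) (nilradical R) ` Units R"
    then obtain x where x: "x \<in> Units R" "X = nilradical R +> x" by blast
    have c: "x \<in> carrier R" "inv x \<in> carrier R" using x(1) by auto
    have "X \<otimes>\<^bsub>reduced_ring R\<^esub> (nilradical R +> inv x) = \<one>\<^bsub>reduced_ring R\<^esub>"
      unfolding x(2) using c x(1) h.hom_mult[of x "inv x"] h.hom_one by simp
    moreover have "X \<in> carrier (reduced_ring R)" "nilradical R +> inv x \<in> carrier (reduced_ring R)"
      using c x(2) by (auto simp: carrier_reduced_ring)
    ultimately show "X \<in> Units (reduced_ring R)"
      using h.S.unit_factor[of X "nilradical R +> inv x"] by simp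
  qed
qed

lemma sym_unit_powers_eq:
  "sym_unit_powers R k = (\<lambda>x. x [^] k) ` Units R \<union> (\<lambda>x. \<ominus> (x [^] k)) ` Units R"
  by (auto simp: sym_unit_powers_def unit_powers_def)

lemma uminus_Units: "u \<in> Units R \<Longrightarrow> \<ominus> u \<in> Units R"
proof -
  assume u: "u \<in> Units R"
  have "(\<ominus> u) \<otimes> (\<ominus> (inv u)) = \<one>" using u by (simp add: l_minus r_minus Units_closed)
  thus "\<ominus> u \<in> Units R" using u by (intro unit_factor[of "\<ominus> u" "\<ominus> (inv u)"]) auto
qed

lemma pow_Units: "u \<in> Units R \<Longrightarrow> u [^] (k::nat) \<in> Units R"
  by (induction k) auto

lemma inv_uminus: "u \<in> Units R \<Longrightarrow> inv (\<ominus> u) = \<ominus> (inv u)"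
  by (intro comm_inv_char) (auto simp: l_minus r_minus Units_closed)

lemma inv_pow: "u \<in> Units R \<Longrightarrow> inv (u [^] k) = inv u [^] (k::nat)"
  by (intro comm_inv_char) (auto simp: nat_pow_distrib[symmetric] Units_closed)

lemma subgroup_sym_unit_powers: "subgroup (sym_unit_powers R k) (units_of R)"
proof -
  interpret U: group "units_of R" by (rule units_group)
  show ?thesis
  proof (rule U.subgroupI)
    show "sym_unit_powers R k \<subseteq> carrier (units_of R)"
      by (auto simp: sym_unit_powers_eq units_of_carrier pow_Units uminus_Units)
    show "sym_unit_powers R k \<noteq> {}" by (auto simp: sym_unit_powers_eq)
  next
    fix s assume "s \<in> sym_unit_powers R k"
    then obtain x where x: "x \<in> Units R" "s = x [^] k \<or> s = \<ominus> (x [^] k)"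
      by (auto simp: sym_unit_powers_eq)
    hence "inv\<^bsub>units_of R\<^esub> s = inv s" by (auto simp: units_of_inv pow_Units uminus_Units)
    hence "inv\<^bsub>units_of R\<^esub> s = inv x [^] k \<or> inv\<^bsub>units_of R\<^esub> s = \<ominus> (inv x [^] k)"
      using x by (auto simp: inv_pow inv_uminus pow_Units)
    thus "inv\<^bsub>units_of R\<^esub> s \<in> sym_unit_powers R k" using x(1) by (auto simp: sym_unit_powers_eq)
  next
    fix s t assume "s \<in> sym_unit_powers R k" "t \<in> sym_unit_powers R k"
    then obtain x y where x: "x \<in> Units R" "s = x [^] k \<or> s = \<ominus> (x [^] k)"
      and y: "y \<in> Units R" "t = y [^] k \<or> t = \<ominus> (y [^] k)"
      by (auto simp: sym_unit_powers_eq)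
    hence "s \<otimes> t = (x \<otimes> y) [^] k \<or> s \<otimes> t = \<ominus> ((x \<otimes> y) [^] k)"
      by (auto simp: nat_pow_distrib Units_closed l_minus r_minus)
    thus "s \<otimes>\<^bsub>units_of R\<^esub> t \<in> sym_unit_powers R k"
      using x(1) y(1) Units_m_closed[of x y] by (auto simp: sym_unit_powers_eq units_of_mult)
  qed
qed

lemma sym_unit_powers_reduced_ring:
  "sym_unit_powers (reduced_ring R) k = (+>) (nilradical R) ` sym_unit_powers R k"
proof -
  interpret h: ring_hom_cring R "reduced_ring R" "(+>) (nilradical R)" by (rule reduction_hom)
  show ?thesis
    unfolding h.S.sym_unit_powers_eq sym_unit_powers_eq Units_reduced_ring image_Un image_image
    by (intro arg_cong2[of _ _ _ _ "(\<union>)"] image_cong)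
       (auto simp: reduction_pow Units_closed)
qed

text \<open>
  Since \<open>1 + N\<close> consists of \<open>k\<close>-th powers, adding a nilpotent element to \<open>x\<^sup>k\<close> only
  multiplies it by a \<open>k\<close>-th power. The elements \<open>-x\<^sup>k\<close> reduce to this case by changing the sign.
\<close>
lemma sym_unit_powers_add_nilpotent:
  assumes "finite (carrier R)" "k > 0" "coprime k (card (carrier R))"
    and t: "t \<in> sym_unit_powers R k" and a: "a \<in> nilradical R"
  shows "t \<oplus> a \<in> sym_unit_powers R k"
proof -
  interpret U: group "units_of R" by (rule units_group)
  let ?V = "(\<oplus>) \<one> ` nilradical R"
  have sub: "nilradical R \<subseteq> carrier R" using nilradical_carrier by blast
  have "card (nilradical R) dvd card (carrier R)"
    using a_lagrange[OF assms(1), of "nilradical R"] ideal.axioms(1)[OF ideal_nilradical]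
    by (metis dvd_triv_right order_def)
  moreover have "inj_on ((\<oplus>) \<one>) (nilradical R)"
    using sub by (intro inj_onI) (auto simp: subset_iff)
  ultimately have cop: "coprime k (card ?V)"
    using assms(3) by (auto simp: card_image intro: coprime_divisors[OF dvd_refl])
  have fin: "finite ?V" using sub assms(1) by (auto intro: finite_subset)
  have root: "\<exists>y\<in>Units R. y [^] k = \<one> \<oplus> b" if b: "b \<in> nilradical R" for b
  proof -
    obtain g where g: "g \<in> ?V" "g [^]\<^bsub>units_of R\<^esub> k = \<one> \<oplus> b"
      using U.coprime_power_surj[OF subgroup_one_plus_nilradical fin assms(2) cop, of "\<one> \<oplus> b"] b
      by blast
    have "g \<in> Units R" using g(1) one_plus_nilpotent_unit by auto
    thus ?thesis using g(2) by (auto simp: units_of_pow)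
  qed
  have shift: "\<exists>z\<in>Units R. x [^] k \<oplus> b = z [^] k" if x: "x \<in> Units R" and b: "b \<in> nilradical R" for x b
  proof -
    have u: "x [^] k \<in> Units R" using x by (rule pow_Units)
    have c: "x [^] k \<in> carrier R" "inv (x [^] k) \<in> carrier R" "b \<in> carrier R"
      using u b nilradical_carrier by auto
    obtain y where y: "y \<in> Units R" "y [^] k = \<one> \<oplus> inv (x [^] k) \<otimes> b"
      using root[OF nilradical_mult[OF b c(2)]] by blast
    have "(x \<otimes> y) [^] k = x [^] k \<otimes> (\<one> \<oplus> inv (x [^] k) \<otimes> b)"
      using x y by (simp add: nat_pow_distrib Units_closed)
    also have "\<dots> = x [^] k \<oplus> (x [^] k \<otimes> inv (x [^] k)) \<otimes> b"
      using c by (simp add: r_distr m_assoc)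
    also have "\<dots> = x [^] k \<oplus> b" using u c by simp
    finally show ?thesis using x y(1) by (intro bexI[of _ "x \<otimes> y"]) auto
  qed
  obtain x where x: "x \<in> Units R" "t = x [^] k \<or> t = \<ominus> (x [^] k)"
    using t by (auto simp: sym_unit_powers_eq)
  from x(2) show ?thesis
  proof
    assume "t = x [^] k"
    thus ?thesis using shift[OF x(1) a] by (auto simp: sym_unit_powers_eq)
  next
    assume t: "t = \<ominus> (x [^] k)"
    obtain z where z: "z \<in> Units R" "x [^] k \<oplus> \<ominus> a = z [^] k"
      using shift[OF x(1) nilradical_minus[OF a]] by blast
    have "t \<oplus> a = \<ominus> (x [^] k \<oplus> \<ominus> a)"
      using t x(1) nilradical_carrier[OF a] by (simp add: minus_add Units_closed)
    thus ?thesis using z by (auto simp: sym_unit_powers_eq)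
  qed
qed

text \<open>
  The connection set is a union of cosets of the nilradical, so membership can be tested after
  reduction.
\<close>
lemma sym_unit_powers_reduction_iff:
  assumes "finite (carrier R)" "k > 0" "coprime k (card (carrier R))" "c \<in> carrier R"
  shows "nilradical R +> c \<in> sym_unit_powers (reduced_ring R) k \<longleftrightarrow> c \<in> sym_unit_powers R k"
proof
  assume "nilradical R +> c \<in> sym_unit_powers (reduced_ring R) k"
  then obtain t where t: "t \<in> sym_unit_powers R k" "nilradical R +> c = nilradical R +> t"
    by (auto simp: sym_unit_powers_reduced_ring)
  have tc: "t \<in> carrier R"
    using t(1) subgroup.subset[OF subgroup_sym_unit_powers] by (auto simp: units_of_carrier)
  have "c \<ominus> t \<in> nilradical R" using t(2) reduction_eq_iff[OF tc assms(4)] by simp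
  hence "t \<oplus> (c \<ominus> t) \<in> sym_unit_powers R k"
    using assms(1-3) t(1) by (intro sym_unit_powers_add_nilpotent)
  moreover have "t \<oplus> (c \<ominus> t) = c" using tc assms(4) by algebra
  ultimately show "c \<in> sym_unit_powers R k" by simp
qed (auto simp: sym_unit_powers_reduced_ring)

text \<open>
  Invariance under a translation is inherited by the image in the reduced ring, where the image of the
  connection set is again a group of units and so admits only the translation by \<open>0\<close>.
\<close>
lemma nilpotent_if_sym_unit_powers_invariant:
  assumes "finite (carrier R)" "c \<in> carrier R"
    and "\<And>t. t \<in> sym_unit_powers R k \<Longrightarrow> t \<oplus> c \<in> sym_unit_powers R k"
  shows "c \<in> nilradical R"
proof -
  interpret h: ring_hom_cring R "reduced_ring R" "(+>) (nilradical R)" by (rule reduction_hom)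
  have sub: "sym_unit_powers R k \<subseteq> carrier R"
    using subgroup.subset[OF subgroup_sym_unit_powers] by (auto simp: units_of_carrier)
  have "nilradical R +> c = \<zero>\<^bsub>reduced_ring R\<^esub>"
  proof (rule h.S.unit_group_translation_free)
    show "finite (carrier (reduced_ring R))" using assms(1) by (simp add: carrier_reduced_ring)
    show "subgroup (sym_unit_powers (reduced_ring R) k) (units_of (reduced_ring R))"
      by (rule h.S.subgroup_sym_unit_powers)
    show "nilradical R +> c \<in> carrier (reduced_ring R)" using assms(2) by simp
  next
    fix X assume "X \<in> sym_unit_powers (reduced_ring R) k"
    then obtain t where t: "t \<in> sym_unit_powers R k" "X = nilradical R +> t"
      by (auto simp: sym_unit_powers_reduced_ring)
    hence "X \<oplus>\<^bsub>reduced_ring R\<^esub> (nilradical R +> c) = nilradical R +> (t \<oplus> c)"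
      using sub assms(2) by (auto simp: subset_iff)
    thus "X \<oplus>\<^bsub>reduced_ring R\<^esub> (nilradical R +> c) \<in> sym_unit_powers (reduced_ring R) k"
      using assms(3)[OF t(1)] by (simp add: sym_unit_powers_reduced_ring)
  qed (rule reduced_ring_reduced)
  hence "nilradical R +> c = nilradical R +> \<zero>" using h.hom_zero by simp
  thus ?thesis using assms(2) by (subst (asm) reduction_eq_iff) (auto simp: a_minus_def)
qed

section \<open>The reduced graph\<close>

lemma arc_sym_unitary_cayley_graph:
  "(v, w) \<in> parcs (sym_unitary_cayley_graph R k) \<longleftrightarrow>
     v \<in> carrier R \<and> w \<in> carrier R \<and> w \<ominus> v \<in> sym_unit_powers R k"
  by (simp add: sym_unitary_cayley_graph_def cayley_graph_def)

lemma pverts_sym_unitary_cayley_graph: "pverts (sym_unitary_cayley_graph R k) = carrier R"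
  by (simp add: sym_unitary_cayley_graph_def cayley_graph_def)

lemma arc_reduction_iff:
  assumes "finite (carrier R)" "k > 0" "coprime k (card (carrier R))"
    and "v \<in> carrier R" "w \<in> carrier R"
  shows "(nilradical R +> v, nilradical R +> w) \<in> parcs (sym_unitary_cayley_graph (reduced_ring R) k)
    \<longleftrightarrow> (v, w) \<in> parcs (sym_unitary_cayley_graph R k)"
proof -
  interpret h: ring_hom_cring R "reduced_ring R" "(+>) (nilradical R)" by (rule reduction_hom)
  have "(nilradical R +> w) \<ominus>\<^bsub>reduced_ring R\<^esub> (nilradical R +> v) = nilradical R +> (w \<ominus> v)"
    using assms(4,5) by (simp add: a_minus_def)
  thus ?thesis
    using assms sym_unit_powers_reduction_iff[OF assms(1-3), of "w \<ominus> v"]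
    by (simp add: h.S.arc_sym_unitary_cayley_graph arc_sym_unitary_cayley_graph)
qed

text \<open>
  Adjacency depends only on the cosets of the two endpoints, so elements of one coset have the same
  neighbours. Conversely, the neighbours \<open>b + t\<close> of \<open>b\<close> are also neighbours of \<open>a\<close>
  only if translation by \<open>b - a\<close> preserves the connection set.
\<close>
lemma same_nbrs_sym_unitary_cayley_graph:
  assumes "finite (carrier R)" "k > 0" "coprime k (card (carrier R))"
    and a: "a \<in> carrier R"
  shows "same_nbrs (sym_unitary_cayley_graph R k) `` {a} = nilradical R +> a"
proof -
  let ?\<Gamma> = "sym_unitary_cayley_graph R k"
  have "nbrs ?\<Gamma> b = nbrs ?\<Gamma> a \<longleftrightarrow> nilradical R +> b = nilradical R +> a" if b: "b \<in> carrier R" for b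
  proof
    assume eq: "nilradical R +> b = nilradical R +> a"
    show "nbrs ?\<Gamma> b = nbrs ?\<Gamma> a"
      unfolding nbrs_def pverts_sym_unitary_cayley_graph
      using arc_reduction_iff[OF assms(1-3) a] arc_reduction_iff[OF assms(1-3) b] eq by auto
  next
    assume eq: "nbrs ?\<Gamma> b = nbrs ?\<Gamma> a"
    have "b \<ominus> a \<in> nilradical R"
    proof (rule nilpotent_if_sym_unit_powers_invariant[OF assms(1)])
      show "b \<ominus> a \<in> carrier R" using a b by simp
      fix t assume t: "t \<in> sym_unit_powers R k"
      hence tc: "t \<in> carrier R"
        using subgroup.subset[OF subgroup_sym_unit_powers] by (auto simp: units_of_carrier)
      have "b \<oplus> t \<ominus> b = t" using b tc by algebra
      hence "b \<oplus> t \<in> nbrs ?\<Gamma> b"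
        using b t tc by (simp add: nbrs_def pverts_sym_unitary_cayley_graph arc_sym_unitary_cayley_graph)
      hence "b \<oplus> t \<ominus> a \<in> sym_unit_powers R k"
        unfolding eq by (simp add: nbrs_def arc_sym_unitary_cayley_graph)
      moreover have "b \<oplus> t \<ominus> a = t \<oplus> (b \<ominus> a)" using a b tc by algebra
      ultimately show "t \<oplus> (b \<ominus> a) \<in> sym_unit_powers R k" by simp
    qed
    thus "nilradical R +> b = nilradical R +> a" using reduction_eq_iff[OF a b] by simp
  qed
  thus ?thesis
    using a by (subst reduction_coset[OF a])
      (auto simp: same_nbrs_def pverts_sym_unitary_cayley_graph)
qed

lemma reduced_graph_sym_unitary_cayley_graph:
  assumes "finite (carrier R)" "k > 0" "coprime k (card (carrier R))"
  shows "reduced_graph (sym_unitary_cayley_graph R k) = sym_unitary_cayley_graph (reduced_ring R) k"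
    (is "reduced_graph ?\<Gamma> = ?\<Gamma>'")
proof -
  interpret h: ring_hom_cring R "reduced_ring R" "(+>) (nilradical R)" by (rule reduction_hom)
  note cls = same_nbrs_sym_unitary_cayley_graph[OF assms]
  have "pverts ?\<Gamma> // same_nbrs ?\<Gamma> = pverts ?\<Gamma>'"
    by (auto simp: quotient_def cls pverts_sym_unitary_cayley_graph
        h.S.pverts_sym_unitary_cayley_graph carrier_reduced_ring)
  moreover have "{(same_nbrs ?\<Gamma> `` {a}, same_nbrs ?\<Gamma> `` {b}) | a b.
      a \<in> pverts ?\<Gamma> \<and> b \<in> pverts ?\<Gamma> \<and> (a, b) \<in> parcs ?\<Gamma>} = parcs ?\<Gamma>'" (is "?A = _")
  proof (intro equalityI subrelI)
    fix X Y assume "(X, Y) \<in> ?A"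
    thus "(X, Y) \<in> parcs ?\<Gamma>'"
      using arc_reduction_iff[OF assms] by (auto simp: cls pverts_sym_unitary_cayley_graph)
  next
    fix X Y assume XY: "(X, Y) \<in> parcs ?\<Gamma>'"
    then obtain a b where a: "a \<in> carrier R" "X = nilradical R +> a"
      and b: "b \<in> carrier R" "Y = nilradical R +> b"
      by (auto simp: h.S.arc_sym_unitary_cayley_graph carrier_reduced_ring)
    have "(a, b) \<in> parcs ?\<Gamma>" using XY arc_reduction_iff[OF assms a(1) b(1)] a(2) b(2) by simp
    hence "(same_nbrs ?\<Gamma> `` {a}, same_nbrs ?\<Gamma> `` {b}) \<in> ?A"
      using a(1) b(1) unfolding pverts_sym_unitary_cayley_graph by blast
    thus "(X, Y) \<in> ?A" using a b by (simp only: cls)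
  qed
  ultimately show ?thesis unfolding reduced_graph_def by simp
qed

end

lemma digraph_iso_refl:
  assumes "wf_digraph G"
  shows "digraph_iso G G"
  unfolding digraph_iso_def
proof (intro exI conjI)
  let ?f = "\<lparr>iso_verts = id, iso_arcs = id, iso_head = head G, iso_tail = tail G\<rparr>"
  show "pre_digraph.digraph_isomorphism G ?f"
    using assms by (simp add: pre_digraph.digraph_isomorphism_def)
  show "G = app_iso ?f G" by (simp add: app_iso_def)
qed

lemma wf_digraph_cayley_graph: "wf_digraph (with_proj (cayley_graph A S))"
  unfolding wf_digraph_wp_iff by unfold_locales (auto simp: cayley_graph_def)

theorem theorem7p10:
  fixes R :: "('a, 'm) ring_scheme" and Rs :: "('b, 'n) ring_scheme list" and k :: nat
  assumes "cring R" and "finite (carrier R)"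
    and "\<And>i. i < length Rs \<Longrightarrow> local_ring (Rs ! i)"
    and "R \<simeq> RDirProd_list Rs"
    and "k > 0" and "gcd k (card (carrier R)) = 1"
    and "\<exists>\<^sub>\<le>\<^sub>1 j. j < length Rs \<and> \<ominus>\<^bsub>Rs ! j\<^esub> \<one>\<^bsub>Rs ! j\<^esub> \<notin> unit_powers (Rs ! j) k"
  shows "digraph_iso (with_proj (reduced_graph (sym_unitary_cayley_graph R k)))
                     (with_proj (sym_unitary_cayley_graph (reduced_ring R) k))"
proof -
  interpret cring R by (rule assms(1))
  have "coprime k (card (carrier R))" using assms(6) by (simp add: coprime_iff_gcd_eq_1)
  thus ?thesis
    using reduced_graph_sym_unitary_cayley_graph[OF assms(2,5)]
    by (simp add: digraph_iso_refl wf_digraph_cayley_graph sym_unitary_cayley_graph_def)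
qed

end
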